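(* Fix $\theta\in\{0,1\}$, a limiter function $\psi:\mathbb{R}\to\mathbb{R}$ with $\psi(0)=0$, and constants $M_\psi\in[0,\infty)$, $m_\psi\in(-\infty,0]$. Consider the forward Euler flux-form scheme $u^n\mapsto u^{n+1}$ described in the context, with face velocities $c$. Assume: 1. (Discrete incompressibility) $c_{i+1/2,j}-c_{i-1/2,j}+c_{i,j+1/2}-c_{i,j-1/2}=0$ for all $(i,j)$. 2. (Limiter region) If $\theta=1$: $\psi(R)\in[0,M_\psi]$ for all $R\in\mathbb{R}$ and $\psi(S)/S\in[m_\psi,2]$ for all $S\in\mathbb{R}\setminus\{0\}$. If $\theta=0$: $\psi(1/R)\in[m_\psi,2]$ for all $R\in\mathbb{R}\setminus\{0\}$ and $S\,\psi(1/S)\in[0,M_\psi]$ for all $S\in\mathbb{R}\setminus\{0\}$. 3. (Time step restriction) For all $(i,j)$, $$c_{i+1/2,j}^{+}-c_{i-1/2,j}^{-}+c_{i,j+1/2}^{+}-c_{i,j-1/2}^{-}\le \frac{2}{2+M_\psi-m_\psi}.$$ Then for every $u^n$ and every $(i,j)$, the value $u^{n+1}_{i,j}$ is a convex combination of $u^n_{i,j},u^n_{i-1,j},u^n_{i+1,j},u^n_{i,j-1},u^n_{i,j+1}$; that is, there exist numbers $A,B,C,D\ge 0$ (depending on $u^n$, $c$ and $(i,j)$) with $A+B+C+D\le 1$ and $$u^{n+1}_{i,j}=\bigl(1-(A+B+C+D)\bigr)u^n_{i,j}+A\,u^n_{i-1,j}+B\,u^n_{i+1,j}+C\,u^n_{i,j-1}+D\,u^n_{i,j+1}.$$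 As a result, the discrete local maximum principle holds: $$u^{n+1}_{i,j}\in\Bigl[\min\{u^n_{i,j},u^n_{i\pm1,j},u^n_{i,j\pm1}\},\ \max\{u^n_{i,j},u^n_{i\pm1,j},u^n_{i,j\pm1}\}\Bigr].$$
   Context: Cells are indexed by $(i,j)\in\mathbb{Z}^2$ (periodic grids are a special case), and $u=(u_{i,j})$ is a real-valued grid function. Face velocities are real numbers $c_{i+1/2,j}$ ($x$-component at the face between cells $(i,j)$ and $(i+1,j)$) and $c_{i,j+1/2}$ ($y$-component at the face between cells $(i,j)$ and $(i,j+1)$); the time step and mesh spacing have been absorbed into $c$. Write $a^+=\max(a,0)$, $a^-=\min(a,0)$. Reconstruction. With $R_i=\frac{u_{i+1,j}-u_{i,j}}{u_{i,j}-u_{i-1,j}}$ and $R_j=\frac{u_{i,j+1}-u_{i,j}}{u_{i,j}-u_{i,j-1}}$, the right, left, up and down values of cell $(i,j)$ are $$u^R_{i,j}=u_{i,j}+\tfrac{\theta}{2}\psi(R_i)(u_{i,j}-u_{i-1,j})+\tfrac{1-\theta}{2}\psi(1/R_i)(u_{i+1,j}-u_{i,j}),$$ $$u^L_{i,j}=u_{i,j}+\tfrac{\theta}{2}\psi(1/R_i)(u_{i,j}-u_{i+1,j})-\tfrac{1-\theta}{2}\psi(R_i)(u_{i,j}-u_{i-1,j}),$$ $$u^U_{i,j}=u_{i,j}+\tfrac{\theta}{2}\psi(R_j)(u_{i,j}-u_{i,j-1})+\tfrac{1-\theta}{2}\psi(1/R_j)(u_{i,j+1}-u_{i,j}),$$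 $$u^D_{i,j}=u_{i,j}+\tfrac{\theta}{2}\psi(1/R_j)(u_{i,j}-u_{i,j+1})-\tfrac{1-\theta}{2}\psi(R_j)(u_{i,j}-u_{i,j-1}).$$ Here $1/R_i$ denotes the reciprocal ratio $\frac{u_{i,j}-u_{i-1,j}}{u_{i+1,j}-u_{i,j}}$ (similarly $1/R_j$). Convention for vanishing denominators: every limiter term above has the form $\pm\psi(p/q)\,q$, with $p,q$ successive differences of $u$, and is interpreted as $0$ when $q=0$. Donor cell fluxes: $$F_{i+1/2,j}=c^+_{i+1/2,j}u^R_{i,j}+c^-_{i+1/2,j}u^L_{i+1,j},\qquad F_{i,j+1/2}=c^+_{i,j+1/2}u^U_{i,j}+c^-_{i,j+1/2}u^D_{i,j+1}.$$ Forward Euler scheme (all reconstructions computed from $u=u^n$): $$u^{n+1}_{i,j}=u^n_{i,j}-\bigl[F_{i+1/2,j}-F_{i-1/2,j}\bigr]-\bigl[F_{i,j+1/2}-F_{i,j-1/2}\bigr].$$ *)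

theory Defs
  imports Complex_Main
begin

(* Face quantities carry the index of the cell on their lower side: cx i j and flux_x ... i j live
   at the face (i+1/2, j), cy i j and flux_y ... i j at (i, j+1/2).  Hence (i-1/2, j) is cx (i - 1) j. *)

type_synonym grid = "int \<Rightarrow> int \<Rightarrow> real"

definition ratio_x :: "grid \<Rightarrow> grid" where
  "ratio_x u i j = (u (i + 1) j - u i j) / (u i j - u (i - 1) j)"

definition ratio_y :: "grid \<Rightarrow> grid" where
  "ratio_y u i j = (u i (j + 1) - u i j) / (u i j - u i (j - 1))"

(* Every limiter term below is +-psi(p/q) * q.  Since the factor q is kept explicit, the term is 0
   whenever q = 0, for every psi.  Because x / 0 = 0, also 1 / (p / q) = q / p for all p and q
   (including p = 0 or q = 0), so 1 / ratio_x is the reciprocal ratio of differences without any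
   side condition. *)

definition recon_R :: "real \<Rightarrow> (real \<Rightarrow> real) \<Rightarrow> grid \<Rightarrow> grid" where
  "recon_R \<theta> \<psi> u i j = u i j
     + \<theta> / 2 * \<psi> (ratio_x u i j) * (u i j - u (i - 1) j)
     + (1 - \<theta>) / 2 * \<psi> (1 / ratio_x u i j) * (u (i + 1) j - u i j)"

definition recon_L :: "real \<Rightarrow> (real \<Rightarrow> real) \<Rightarrow> grid \<Rightarrow> grid" where
  "recon_L \<theta> \<psi> u i j = u i j
     + \<theta> / 2 * \<psi> (1 / ratio_x u i j) * (u i j - u (i + 1) j)
     - (1 - \<theta>) / 2 * \<psi> (ratio_x u i j) * (u i j - u (i - 1) j)"

definition recon_U :: "real \<Rightarrow> (real \<Rightarrow> real) \<Rightarrow> grid \<Rightarrow> grid" where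
  "recon_U \<theta> \<psi> u i j = u i j
     + \<theta> / 2 * \<psi> (ratio_y u i j) * (u i j - u i (j - 1))
     + (1 - \<theta>) / 2 * \<psi> (1 / ratio_y u i j) * (u i (j + 1) - u i j)"

definition recon_D :: "real \<Rightarrow> (real \<Rightarrow> real) \<Rightarrow> grid \<Rightarrow> grid" where
  "recon_D \<theta> \<psi> u i j = u i j
     + \<theta> / 2 * \<psi> (1 / ratio_y u i j) * (u i j - u i (j + 1))
     - (1 - \<theta>) / 2 * \<psi> (ratio_y u i j) * (u i j - u i (j - 1))"

definition flux_x :: "real \<Rightarrow> (real \<Rightarrow> real) \<Rightarrow> grid \<Rightarrow> grid \<Rightarrow> grid" where
  "flux_x \<theta> \<psi> cx u i j =
     max (cx i j) 0 * recon_R \<theta> \<psi> u i j + min (cx i j) 0 * recon_L \<theta> \<psi> u (i + 1) j"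

definition flux_y :: "real \<Rightarrow> (real \<Rightarrow> real) \<Rightarrow> grid \<Rightarrow> grid \<Rightarrow> grid" where
  "flux_y \<theta> \<psi> cy u i j =
     max (cy i j) 0 * recon_U \<theta> \<psi> u i j + min (cy i j) 0 * recon_D \<theta> \<psi> u i (j + 1)"

definition euler_step :: "real \<Rightarrow> (real \<Rightarrow> real) \<Rightarrow> grid \<Rightarrow> grid \<Rightarrow> grid \<Rightarrow> grid" where
  "euler_step \<theta> \<psi> cx cy u i j = u i j
     - (flux_x \<theta> \<psi> cx u i j - flux_x \<theta> \<psi> cx u (i - 1) j)
     - (flux_y \<theta> \<psi> cy u i j - flux_y \<theta> \<psi> cy u i (j - 1))"

end

theory Submission
  imports Defs
begin

text \<open>
  The correction that turns the cell average into a face value equals both \<open>\<alpha>/2\<close> times the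
  difference across the far face of the cell and \<open>\<beta>/2\<close> times the difference across
  the near face, with \<open>\<alpha> \<in> [0, M]\<close> and \<open>\<beta> \<in> [m, 2]\<close>.  Subtracting
  \<open>u\<^sub>i\<^sub>j\<close> times the vanishing discrete divergence from the flux difference, outgoing faces
  are expanded with \<open>\<alpha>\<close> and incoming ones with \<open>\<beta>\<close>; every neighbour then gets a
  nonnegative weight, at most \<open>M/2\<close> per unit of outflow and \<open>1 - m/2\<close> per unit of
  inflow.  Outflow equals inflow by incompressibility, so the weights add up to at most
  \<open>(2 + M - m)/2\<close> times the outflow, which the time step restriction bounds by 1.
\<close>

text \<open>Here \<open>b\<close> is the difference across the face being reconstructed and
  \<open>a\<close> the one across the opposite face of the cell. Naming them by position instead of
  direction lets one expression serve both one-sided values, with the two differences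
  exchanged.\<close>

definition limited_slope :: "real \<Rightarrow> (real \<Rightarrow> real) \<Rightarrow> real \<Rightarrow> real \<Rightarrow> real" where
  "limited_slope \<theta> \<psi> a b = \<theta> * \<psi> (b / a) * a + (1 - \<theta>) * \<psi> (a / b) * b"

lemma recon_R_eq_limited_slope:
  "recon_R \<theta> \<psi> u i j = u i j + limited_slope \<theta> \<psi> (u i j - u (i - 1) j) (u (i + 1) j - u i j) / 2"
  unfolding recon_R_def limited_slope_def ratio_x_def by (simp add: add_divide_distrib)

lemma recon_L_eq_limited_slope:
  "recon_L \<theta> \<psi> u i j = u i j - limited_slope \<theta> \<psi> (u (i + 1) j - u i j) (u i j - u (i - 1) j) / 2"
proof -
  have "\<theta> / 2 * x * (u i j - u (i + 1) j) = - (\<theta> * x * (u (i + 1) j - u i j) / 2)" for x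
    by (simp add: field_simps)
  then show ?thesis
    unfolding recon_L_def limited_slope_def ratio_x_def by (simp add: add_divide_distrib)
qed

text \<open>Isolates what the flux estimate uses about \<open>\<psi>\<close> and
  \<open>\<theta>\<close>. The factors may depend on \<open>a\<close> and \<open>b\<close>, but both
  must represent the same slope.\<close>

definition slope_bounds :: "real \<Rightarrow> (real \<Rightarrow> real) \<Rightarrow> real \<Rightarrow> real \<Rightarrow> bool" where
  "slope_bounds \<theta> \<psi> M m \<longleftrightarrow> (\<forall>a b. \<exists>\<alpha>\<in>{0..M}. \<exists>\<beta>\<in>{m..2}.
     limited_slope \<theta> \<psi> a b = \<alpha> * a \<and> limited_slope \<theta> \<psi> a b = \<beta> * b)"

lemma slope_boundsE:
  assumes "slope_bounds \<theta> \<psi> M m"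
  obtains \<alpha> \<beta> where "0 \<le> \<alpha>" "\<alpha> \<le> M" "m \<le> \<beta>" "\<beta> \<le> 2"
    "limited_slope \<theta> \<psi> a b = \<alpha> * a" "limited_slope \<theta> \<psi> a b = \<beta> * b"
  using assms unfolding slope_bounds_def by (meson atLeastAtMost_iff)

text \<open>With \<open>S = b / a\<close>, the slope is
  \<open>\<psi> S * a = (\<psi> S / S) * b\<close> for \<open>\<theta> = 1\<close>, and
  \<open>\<psi> (1 / S) * b = (S * \<psi> (1 / S)) * a\<close> for \<open>\<theta> = 0\<close>. The
  coefficients are exactly the quantities that the limiter region bounds.\<close>

lemma slope_bounds_limiter_region:
  fixes \<theta> M m :: real and \<psi> :: "real \<Rightarrow> real"
  assumes theta: "\<theta> \<in> {0, 1}" and psi0: "\<psi> 0 = 0" and M: "M \<ge> 0" and m: "m \<le> 0"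
    and region1: "\<theta> = 1 \<Longrightarrow>
      (\<forall>R. \<psi> R \<in> {0..M}) \<and> (\<forall>S. S \<noteq> 0 \<longrightarrow> \<psi> S / S \<in> {m..2})"
    and region0: "\<theta> = 0 \<Longrightarrow>
      (\<forall>R. R \<noteq> 0 \<longrightarrow> \<psi> (1 / R) \<in> {m..2}) \<and> (\<forall>S. S \<noteq> 0 \<longrightarrow> S * \<psi> (1 / S) \<in> {0..M})"
  shows "slope_bounds \<theta> \<psi> M m"
  unfolding slope_bounds_def
proof (intro allI)
  fix a b :: real
  let ?P = "\<lambda>\<alpha> \<beta>. limited_slope \<theta> \<psi> a b = \<alpha> * a \<and> limited_slope \<theta> \<psi> a b = \<beta> * b"
  show "\<exists>\<alpha>\<in>{0..M}. \<exists>\<beta>\<in>{m..2}. ?P \<alpha> \<beta>"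
  proof (cases "a = 0 \<or> b = 0")
    case True
    \<comment> \<open>If only one difference vanishes, the term carrying the other one has limiter
      argument 0, so \<open>\<psi> 0 = 0\<close> makes the whole slope vanish.\<close>
    then have "?P 0 0" using psi0 by (auto simp: limited_slope_def)
    then show ?thesis using M m by force
  next
    case False
    then have nz: "a \<noteq> 0" "b \<noteq> 0" by auto
    show ?thesis
    proof (cases "\<theta> = 1")
      case True
      have "b / a \<noteq> 0" using nz by simp
      then have "\<psi> (b / a) \<in> {0..M}" "\<psi> (b / a) / (b / a) \<in> {m..2}"
        using region1[OF True] by blast+
      moreover have "?P (\<psi> (b / a)) (\<psi> (b / a) / (b / a))"
        using True nz by (simp add: limited_slope_def)
      ultimately show ?thesis by blast
    next
      case False
      then have t0: "\<theta> = 0" using theta by auto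
      have "b / a \<noteq> 0" using nz by simp
      then have "\<psi> (1 / (b / a)) \<in> {m..2}" "b / a * \<psi> (1 / (b / a)) \<in> {0..M}"
        using region0[OF t0] by blast+
      then have "\<psi> (a / b) \<in> {m..2}" "b / a * \<psi> (a / b) \<in> {0..M}" by simp_all
      moreover have "?P (b / a * \<psi> (a / b)) (\<psi> (a / b))"
        using t0 nz by (simp add: limited_slope_def)
      ultimately show ?thesis by blast
    qed
  qed
qed

lemma flux_x_difference:
  fixes cx u :: grid
  assumes "slope_bounds \<theta> \<psi> M m"
  obtains A B where "A \<ge> 0" "B \<ge> 0"
    "A + B \<le> M / 2 * (max (cx i j) 0 - min (cx (i - 1) j) 0)
           + (1 - m / 2) * (max (cx (i - 1) j) 0 - min (cx i j) 0)"
    "flux_x \<theta> \<psi> cx u i j - flux_x \<theta> \<psi> cx u (i - 1) j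
      = (cx i j - cx (i - 1) j) * u i j - A * (u (i - 1) j - u i j) - B * (u (i + 1) j - u i j)"
proof -
  \<comment> \<open>Outflow rates are \<open>p\<close> (right face) and \<open>s\<close> (left
    face); inflow rates are \<open>q\<close> (right) and \<open>r\<close> (left).\<close>
  define p q r s where "p = max (cx i j) 0" and "q = - min (cx i j) 0"
    and "r = max (cx (i - 1) j) 0" and "s = - min (cx (i - 1) j) 0"
  have nonneg: "p \<ge> 0" "q \<ge> 0" "r \<ge> 0" "s \<ge> 0"
    by (simp_all add: p_def q_def r_def s_def)
  have split: "cx i j = p - q" "cx (i - 1) j = r - s"
    by (simp_all add: p_def q_def r_def s_def)
  \<comment> \<open>For a value of the cell itself the far face lies on the other side, so outflow
    to the right puts weight on the left neighbour, and conversely.\<close>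
  obtain \<alpha>R where aR: "0 \<le> \<alpha>R" "\<alpha>R \<le> M"
    "recon_R \<theta> \<psi> u i j = u i j - \<alpha>R / 2 * (u (i - 1) j - u i j)"
    by (rule slope_boundsE[OF assms, of "u i j - u (i - 1) j" "u (i + 1) j - u i j"])
       (simp add: recon_R_eq_limited_slope field_simps)
  obtain \<alpha>L where aL: "0 \<le> \<alpha>L" "\<alpha>L \<le> M"
    "recon_L \<theta> \<psi> u i j = u i j - \<alpha>L / 2 * (u (i + 1) j - u i j)"
    by (rule slope_boundsE[OF assms, of "u (i + 1) j - u i j" "u i j - u (i - 1) j"])
       (simp add: recon_L_eq_limited_slope field_simps)
  \<comment> \<open>The neighbour's reconstruction reads \<open>u (i - 2) j\<close>. Expressing its
    correction through the near difference removes that value and keeps the stencil to direct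
    neighbours.\<close>
  obtain \<beta>R where bR: "m \<le> \<beta>R" "\<beta>R \<le> 2"
    "recon_R \<theta> \<psi> u (i - 1) j = u i j + (1 - \<beta>R / 2) * (u (i - 1) j - u i j)"
    by (rule slope_boundsE[OF assms, of "u (i - 1) j - u (i - 2) j" "u i j - u (i - 1) j"])
       (simp add: recon_R_eq_limited_slope field_simps)
  obtain \<beta>L where bL: "m \<le> \<beta>L" "\<beta>L \<le> 2"
    "recon_L \<theta> \<psi> u (i + 1) j = u i j + (1 - \<beta>L / 2) * (u (i + 1) j - u i j)"
    by (rule slope_boundsE[OF assms, of "u (i + 2) j - u (i + 1) j" "u (i + 1) j - u i j"])
       (simp add: recon_L_eq_limited_slope field_simps)
  define A B where "A = p * (\<alpha>R / 2) + r * (1 - \<beta>R / 2)"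
    and "B = s * (\<alpha>L / 2) + q * (1 - \<beta>L / 2)"
  show thesis
  proof (rule that[of A B])
    \<comment> \<open>The upper bound 2 on the limiter enters here: it gives
      \<open>1 - \<beta>R / 2 \<ge> 0\<close> and \<open>1 - \<beta>L / 2 \<ge> 0\<close>.\<close>
    show "A \<ge> 0" "B \<ge> 0"
      unfolding A_def B_def using nonneg aR aL bR bL by auto
    have "p * (\<alpha>R / 2) \<le> p * (M / 2)" "s * (\<alpha>L / 2) \<le> s * (M / 2)"
      "r * (1 - \<beta>R / 2) \<le> r * (1 - m / 2)" "q * (1 - \<beta>L / 2) \<le> q * (1 - m / 2)"
      using nonneg aR aL bR bL by (auto intro!: mult_left_mono)
    then have "A + B \<le> M / 2 * (p + s) + (1 - m / 2) * (r + q)"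
      unfolding A_def B_def distrib_left mult.commute[of "M / 2"] mult.commute[of "1 - m / 2"]
      by linarith
    then show "A + B \<le> M / 2 * (max (cx i j) 0 - min (cx (i - 1) j) 0)
           + (1 - m / 2) * (max (cx (i - 1) j) 0 - min (cx i j) 0)"
      by (simp add: p_def q_def r_def s_def)
    have "flux_x \<theta> \<psi> cx u i j = p * recon_R \<theta> \<psi> u i j - q * recon_L \<theta> \<psi> u (i + 1) j"
      "flux_x \<theta> \<psi> cx u (i - 1) j = r * recon_R \<theta> \<psi> u (i - 1) j - s * recon_L \<theta> \<psi> u i j"
      by (simp_all add: flux_x_def p_def q_def r_def s_def)
    then show "flux_x \<theta> \<psi> cx u i j - flux_x \<theta> \<psi> cx u (i - 1) j
      = (cx i j - cx (i - 1) j) * u i j - A * (u (i - 1) j - u i j) - B * (u (i + 1) j - u i j)"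
      unfolding aR(3) aL(3) bR(3) bL(3) A_def B_def split by (simp add: algebra_simps)
  qed
qed

text \<open>Exchanging the two indices turns the vertical direction into the horizontal one, so the
  estimate for \<open>flux_x\<close> also covers \<open>flux_y\<close>.\<close>

lemma flux_y_transpose:
  "flux_y \<theta> \<psi> cy u i j = flux_x \<theta> \<psi> (\<lambda>k l. cy l k) (\<lambda>k l. u l k) j i"
  by (simp add: flux_y_def flux_x_def recon_U_def recon_R_def recon_D_def recon_L_def
      ratio_y_def ratio_x_def)

lemma convex_combination_in_Min_Max:
  fixes A B C D :: real
  assumes "A \<ge> 0" "B \<ge> 0" "C \<ge> 0" "D \<ge> 0" "A + B + C + D \<le> 1"
  shows "(1 - (A + B + C + D)) * u + A * w + B * e + C * s + D * n
    \<in> {Min {u, w, e, s, n} .. Max {u, w, e, s, n}}" (is "?x \<in> {?lo..?hi}")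
proof -
  let ?E = "1 - (A + B + C + D)"
  have E: "?E \<ge> 0" using assms by simp
  have lo: "?lo \<le> u" "?lo \<le> w" "?lo \<le> e" "?lo \<le> s" "?lo \<le> n" by simp_all
  have hi: "u \<le> ?hi" "w \<le> ?hi" "e \<le> ?hi" "s \<le> ?hi" "n \<le> ?hi" by simp_all
  have affine: "?E * z + A * z + B * z + C * z + D * z = z" for z
    by (simp add: algebra_simps)
  have "?E * ?lo + A * ?lo + B * ?lo + C * ?lo + D * ?lo \<le> ?x"
    by (intro add_mono mult_left_mono lo E assms)
  moreover have "?x \<le> ?E * ?hi + A * ?hi + B * ?hi + C * ?hi + D * ?hi"
    by (intro add_mono mult_left_mono hi E assms)
  ultimately show ?thesis unfolding affine atLeastAtMost_iff by (rule conjI)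
qed

theorem theorem3p1:
  fixes \<theta> M m :: real and \<psi> :: "real \<Rightarrow> real" and cx cy :: grid
  assumes theta: "\<theta> \<in> {0, 1}"
    and psi0: "\<psi> 0 = 0"
    and M: "M \<ge> 0" and m: "m \<le> 0"
    and incompressible: "\<forall>i j. cx i j - cx (i - 1) j + cy i j - cy i (j - 1) = 0"
    and region1: "\<theta> = 1 \<Longrightarrow>
      (\<forall>R. \<psi> R \<in> {0..M}) \<and> (\<forall>S. S \<noteq> 0 \<longrightarrow> \<psi> S / S \<in> {m..2})"
    and region0: "\<theta> = 0 \<Longrightarrow>
      (\<forall>R. R \<noteq> 0 \<longrightarrow> \<psi> (1 / R) \<in> {m..2}) \<and> (\<forall>S. S \<noteq> 0 \<longrightarrow> S * \<psi> (1 / S) \<in> {0..M})"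
    and time_step: "\<forall>i j.
      max (cx i j) 0 - min (cx (i - 1) j) 0 + max (cy i j) 0 - min (cy i (j - 1)) 0
        \<le> 2 / (2 + M - m)"
  shows "\<forall>(u :: grid) i j.
    (\<exists>A B C D :: real. A \<ge> 0 \<and> B \<ge> 0 \<and> C \<ge> 0 \<and> D \<ge> 0 \<and> A + B + C + D \<le> 1 \<and>
       euler_step \<theta> \<psi> cx cy u i j =
         (1 - (A + B + C + D)) * u i j
           + A * u (i - 1) j + B * u (i + 1) j + C * u i (j - 1) + D * u i (j + 1)) \<and>
    euler_step \<theta> \<psi> cx cy u i j
      \<in> {Min {u i j, u (i - 1) j, u (i + 1) j, u i (j - 1), u i (j + 1)} ..
         Max {u i j, u (i - 1) j, u (i + 1) j, u i (j - 1), u i (j + 1)}}"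
proof (intro allI)
  fix u :: grid and i j :: int
  have slopes: "slope_bounds \<theta> \<psi> M m"
    using theta psi0 M m region1 region0 by (rule slope_bounds_limiter_region)
  define Out In where
    "Out = max (cx i j) 0 - min (cx (i - 1) j) 0 + max (cy i j) 0 - min (cy i (j - 1)) 0" and
    "In = max (cx (i - 1) j) 0 - min (cx i j) 0 + max (cy i (j - 1)) 0 - min (cy i j) 0"
  have max_min: "max x 0 + min x 0 = x" for x :: real
    by simp
  have div0: "cx i j - cx (i - 1) j + cy i j - cy i (j - 1) = 0"
    using incompressible by blast
  \<comment> \<open>Since \<open>max x 0 + min x 0 = x\<close>, the difference
    \<open>Out - In\<close> is the discrete divergence.\<close>
  then have "Out = In"
    unfolding Out_def In_def
    using max_min[of "cx i j"] max_min[of "cx (i - 1) j"]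
      max_min[of "cy i j"] max_min[of "cy i (j - 1)"] by linarith
  obtain A B where AB: "A \<ge> 0" "B \<ge> 0"
    "A + B \<le> M / 2 * (max (cx i j) 0 - min (cx (i - 1) j) 0)
           + (1 - m / 2) * (max (cx (i - 1) j) 0 - min (cx i j) 0)"
    and dx: "flux_x \<theta> \<psi> cx u i j - flux_x \<theta> \<psi> cx u (i - 1) j
      = (cx i j - cx (i - 1) j) * u i j - A * (u (i - 1) j - u i j) - B * (u (i + 1) j - u i j)"
    by (rule flux_x_difference[OF slopes])
  obtain C D where CD: "C \<ge> 0" "D \<ge> 0"
    "C + D \<le> M / 2 * (max (cy i j) 0 - min (cy i (j - 1)) 0)
           + (1 - m / 2) * (max (cy i (j - 1)) 0 - min (cy i j) 0)"
    and dy: "flux_y \<theta> \<psi> cy u i j - flux_y \<theta> \<psi> cy u i (j - 1)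
      = (cy i j - cy i (j - 1)) * u i j - C * (u i (j - 1) - u i j) - D * (u i (j + 1) - u i j)"
    unfolding flux_y_transpose by (rule flux_x_difference[OF slopes])
  have "A + B + C + D \<le> M / 2 * Out + (1 - m / 2) * In"
    using AB(3) CD(3) unfolding Out_def In_def by (simp add: algebra_simps)
  also have "\<dots> = (2 + M - m) / 2 * Out"
    using \<open>Out = In\<close> by (simp add: field_simps)
  also have "\<dots> \<le> (2 + M - m) / 2 * (2 / (2 + M - m))"
    using time_step M m by (intro mult_left_mono) (auto simp: Out_def)
  also have "\<dots> = 1"
    using M m by simp
  finally have sum_le: "A + B + C + D \<le> 1" .
  \<comment> \<open>The two flux differences together leave the divergence times
    \<open>u i j\<close>; it is kept as a separate term so that \<open>div0\<close> can cancel
    it.\<close>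
  have "euler_step \<theta> \<psi> cx cy u i j
      = (1 - (A + B + C + D)) * u i j + A * u (i - 1) j + B * u (i + 1) j
        + C * u i (j - 1) + D * u i (j + 1)
        - (cx i j - cx (i - 1) j + cy i j - cy i (j - 1)) * u i j"
    unfolding euler_step_def dx dy by (simp add: algebra_simps)
  then have step: "euler_step \<theta> \<psi> cx cy u i j
      = (1 - (A + B + C + D)) * u i j + A * u (i - 1) j + B * u (i + 1) j
        + C * u i (j - 1) + D * u i (j + 1)"
    unfolding div0 by simp
  show "(\<exists>A B C D :: real. A \<ge> 0 \<and> B \<ge> 0 \<and> C \<ge> 0 \<and> D \<ge> 0 \<and> A + B + C + D \<le> 1 \<and>
       euler_step \<theta> \<psi> cx cy u i j =
         (1 - (A + B + C + D)) * u i j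
           + A * u (i - 1) j + B * u (i + 1) j + C * u i (j - 1) + D * u i (j + 1)) \<and>
    euler_step \<theta> \<psi> cx cy u i j
      \<in> {Min {u i j, u (i - 1) j, u (i + 1) j, u i (j - 1), u i (j + 1)} ..
         Max {u i j, u (i - 1) j, u (i + 1) j, u i (j - 1), u i (j + 1)}}"
    using convex_combination_in_Min_Max[OF AB(1,2) CD(1,2) sum_le,
        of "u i j" "u (i - 1) j" "u (i + 1) j" "u i (j - 1)" "u i (j + 1)", folded step]
    by (intro conjI exI[of _ A] exI[of _ B] exI[of _ C] exI[of _ D] AB(1,2) CD(1,2) sum_le step)
qed

end
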